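(* Let $c>0$. The group $K^+_c$ decomposes into 1-dimensional connected Lie subgroups as \[ K_c^+=SO^+_c(1,1)\ \cup\ \bigcup_{a\in\mathbb R,\,a\neq 0}\Phi_{a,1}\ \cup\ \Phi_{1,0}, \] and any two distinct subgroups among $SO^+_c(1,1)$, $\Phi_{a,1}$ ($a\ne 0$), $\Phi_{1,0}$ intersect only at the unit matrix $\mathbf E$.
   Context: For a fixed real number $c>0$ (the speed of light), $K^+_c$ is the group, under matrix multiplication, of all real $2\times 2$ matrices \[ \mathrm A_c(a,b)=\begin{pmatrix} a & b\\ \frac{b}{c^2} & a\end{pmatrix},\qquad a,b\in\mathbb R,\quad a^2-\frac{b^2}{c^2}>0,\quad a>0 . \] It is a Lie subgroup of $GL(2,\mathbb R)$. $\mathbf E$ is the $2\times2$ identity matrix. For $s\in\mathbb R$, \[ \mathrm L_c^s=\begin{pmatrix}\cosh s & c\sinh s\\ \frac1c\sinh s & \cosh s\end{pmatrix}. \] For $a,b\in\mathbb R$, \[ \Phi_{a,b}=\{\exp(as)\,\mathrm L_c^{bs}\mid s\in\mathbb R\}, \] where $\exp(as)$ is the real exponential, acting as a scalar factor. The group of Lorentz transformations is \[ SO^+_c(1,1)=\Phi_{0,1}=\{\mathrm L_c^s\mid s\in\mathbb R\}=\Big\{\frac{1}{\sqrt{1-u^2/c^2}}\begin{pmatrix}1&u\\ \frac{u}{c^2}&1\end{pmatrix}\ \Big|\ u\in(-c,c)\Big\}. \] Also $\Phi_{1,0}=\{\exp(s)\mathbf E\mid s\in\mathbb R\}$. *)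

theory Defs
  imports "HOL-Analysis.Analysis" "HOL-Algebra.Group"
begin

section \<open>Lie subgroups of matrix groups\<close>

text \<open>\<open>Ck_on k f S\<close> is meant for open \<open>S\<close> in a finite-dimensional space: there, \<open>f\<close> is \<open>C\<^sup>k\<^sup>+\<^sup>1\<close> iff it is
  differentiable and all its directional derivatives are \<open>C\<^sup>k\<close>.\<close>

primrec Ck_on :: "nat \<Rightarrow> ('a::euclidean_space \<Rightarrow> 'b::euclidean_space) \<Rightarrow> 'a set \<Rightarrow> bool" where
  "Ck_on 0 f S \<longleftrightarrow> continuous_on S f"
| "Ck_on (Suc k) f S \<longleftrightarrow>
     (\<forall>x\<in>S. f differentiable (at x)) \<and> (\<forall>v. Ck_on k (\<lambda>x. frechet_derivative f (at x) v) S)"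

definition smooth_on :: "('a::euclidean_space \<Rightarrow> 'b::euclidean_space) \<Rightarrow> 'a set \<Rightarrow> bool" where
  "smooth_on f S \<longleftrightarrow> (\<forall>k. Ck_on k f S)"

definition diffeomorphism ::
    "'a::euclidean_space set \<Rightarrow> 'b::euclidean_space set \<Rightarrow> ('a \<Rightarrow> 'b) \<Rightarrow> ('b \<Rightarrow> 'a) \<Rightarrow> bool" where
  "diffeomorphism U W f g \<longleftrightarrow> open U \<and> open W \<and> homeomorphism U W f g \<and> smooth_on f U \<and> smooth_on g W"

text \<open>Embedded submanifolds of dimension \<open>d\<close>, by local slice charts. The slice is taken along an arbitrary
  \<open>d\<close>-dimensional linear subspace \<open>V\<close>, since the ambient space has no preferred coordinate subspace.\<close>

definition embedded_submanifold :: "nat \<Rightarrow> 'a::euclidean_space set \<Rightarrow> bool" where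
  "embedded_submanifold d M \<longleftrightarrow>
     (\<forall>p\<in>M. \<exists>U W f g V. p \<in> U \<and> diffeomorphism U W f g \<and>
        subspace (V :: 'a set) \<and> dim V = d \<and> f ` (U \<inter> M) = W \<inter> V)"

definition GL :: "(real^'n^'n) monoid" where
  "GL = \<lparr>carrier = {A. invertible A}, mult = (**), one = mat 1\<rparr>"

text \<open>\<open>G\<close> is meant to be a Lie subgroup of \<open>GL\<close>. The group operations of \<open>GL\<close> are smooth, so an abstract
  subgroup which is an embedded submanifold is a Lie group with the induced structure; being embedded, it
  carries the subspace topology.\<close>

definition lie_subgroup :: "nat \<Rightarrow> ('a::euclidean_space, 'b) monoid_scheme \<Rightarrow> 'a set \<Rightarrow> bool" where
  "lie_subgroup d G H \<longleftrightarrow> subgroup H G \<and> embedded_submanifold d H"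


section \<open>The group \<open>K\<^sub>c\<^sup>+\<close> and its one-parameter subgroups\<close>

definition Amat :: "real \<Rightarrow> real \<Rightarrow> real \<Rightarrow> real^2^2" where
  "Amat c a b = vector [vector [a, b], vector [b / c^2, a]]"

definition Kgroup :: "real \<Rightarrow> (real^2^2) monoid" where
  "Kgroup c = GL\<lparr>carrier := {Amat c a b | a b. a^2 - b^2 / c^2 > 0 \<and> a > 0}\<rparr>"

definition Lmat :: "real \<Rightarrow> real \<Rightarrow> real^2^2" where
  "Lmat c s = vector [vector [cosh s, c * sinh s], vector [1 / c * sinh s, cosh s]]"

definition Phi :: "real \<Rightarrow> real \<Rightarrow> real \<Rightarrow> (real^2^2) set" where
  "Phi c a b = {exp (a * s) *\<^sub>R Lmat c (b * s) | s. True}"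

definition SOplus :: "real \<Rightarrow> (real^2^2) set" where
  "SOplus c = Phi c 0 1"

definition Kfamily :: "real \<Rightarrow> (real^2^2) set set" where
  "Kfamily c = {SOplus c} \<union> {Phi c a 1 | a. a \<noteq> 0} \<union> {Phi c 1 0}"


section \<open>Basic facts\<close>

lemma group_GL: "group (GL :: (real^'n^'n) monoid)"
proof (rule groupI)
  fix x :: "real^'n^'n" assume "x \<in> carrier GL"
  then obtain y where "x ** y = mat 1" "y ** x = mat 1"
    by (auto simp: GL_def invertible_def)
  then show "\<exists>y\<in>carrier GL. y \<otimes>\<^bsub>GL\<^esub> x = \<one>\<^bsub>GL\<^esub>"
    by (auto simp: GL_def invertible_def intro!: bexI[of _ y])
next
  have "invertible (mat 1 :: real^'n^'n)"
    unfolding invertible_def by (rule exI[of _ "mat 1"]) simp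
  then show "\<one>\<^bsub>GL\<^esub> \<in> (carrier GL :: (real^'n^'n) set)"
    by (simp add: GL_def)
qed (auto simp: GL_def invertible_mult matrix_mul_assoc)

lemma SOplus_eq_Lmat: "SOplus c = range (Lmat c)"
  by (auto simp: SOplus_def Phi_def)

lemma SOplus_eq_boosts:
  assumes c: "c > 0"
  shows "SOplus c = {(1 / sqrt (1 - u^2 / c^2)) *\<^sub>R vector [vector [1, u], vector [u / c^2, 1]] | u.
           u \<in> {-c<..<c}}" (is "_ = ?R")
proof -
  have boost: "(1 / sqrt (1 - (c * tanh s)^2 / c^2)) *\<^sub>R
      vector [vector [1, c * tanh s], vector [c * tanh s / c^2, 1]] = Lmat c s" for s
  proof -
    have ch: "cosh s > 0" by simp
    have "1 - (c * tanh s)^2 / c^2 = 1 - (tanh s)^2"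
      using c by (simp add: power_mult_distrib)
    also have "\<dots> = (1 / cosh s)^2"
    proof -
      have "(cosh s)^2 - (sinh s)^2 = 1" by (simp add: cosh_square_eq)
      moreover have "1 - (tanh s)^2 = ((cosh s)^2 - (sinh s)^2) / (cosh s)^2"
        using ch by (simp add: tanh_def power_divide diff_divide_distrib)
      ultimately show ?thesis by (simp add: power_divide)
    qed
    finally have "1 / sqrt (1 - (c * tanh s)^2 / c^2) = cosh s"
      using ch by (simp add: real_sqrt_divide)
    then show ?thesis
      using c ch by (simp add: vec_eq_iff forall_2 Lmat_def tanh_def power2_eq_square)
  qed
  have "range (Lmat c) = ?R"
  proof (intro equalityI subsetI)
    fix M assume "M \<in> range (Lmat c)"
    then obtain s where s: "M = Lmat c s" by auto
    have "- c < c * tanh s" "c * tanh s < c"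
      using c tanh_real_gt_neg1[of s] tanh_real_lt_1[of s]
        mult_strict_left_mono[of "-1" "tanh s" c] mult_strict_left_mono[of "tanh s" 1 c] by auto
    then show "M \<in> ?R"
      unfolding s boost[of s, symmetric] by auto
  next
    fix M assume "M \<in> ?R"
    then obtain u where u: "- c < u" "u < c"
      and M: "M = (1 / sqrt (1 - u^2 / c^2)) *\<^sub>R vector [vector [1, u], vector [u / c^2, 1]]"
      by auto
    define t where "t = u / c"
    have t: "- 1 < t" "t < 1"
      using u c by (simp_all add: t_def field_simps)
    have "exp (- 2 * artanh t) = exp (- ln ((1 + t) / (1 - t)))"
      by (simp add: artanh_def)
    also have "\<dots> = (1 - t) / (1 + t)"
      using t by (simp add: exp_minus)
    finally have "tanh (artanh t) = (1 - (1 - t) / (1 + t)) / (1 + (1 - t) / (1 + t))"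
      by (simp add: tanh_real_altdef)
    also have "\<dots> = t"
      using t by (simp add: divide_simps)
    finally have "tanh (artanh (u / c)) = u / c"
      by (simp add: t_def)
    then have "M = Lmat c (artanh (u / c))"
      using boost[of "artanh (u / c)"] c M by simp
    then show "M \<in> range (Lmat c)" by simp
  qed
  then show ?thesis by (simp add: SOplus_eq_Lmat)
qed

lemma Phi_1_0: "Phi c 1 0 = {exp s *\<^sub>R mat 1 | s. True}"
proof -
  have "Lmat c 0 = mat 1"
    by (simp add: Lmat_def vec_eq_iff forall_2 mat_def)
  then show ?thesis by (simp add: Phi_def)
qed

lemma Ck_on_const: "Ck_on k (\<lambda>x. v) S"
  by (induction k arbitrary: v) (auto simp: frechet_derivative_const)

lemma smooth_on_ident: "smooth_on (\<lambda>x. x) S"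
proof -
  have "Ck_on k (\<lambda>x. x) S" for k
    by (cases k) (auto simp: Ck_on_const)
  then show ?thesis by (simp add: smooth_on_def)
qed

lemma subgroup_Kgroup:
  assumes c: "c > 0"
  shows "subgroup (carrier (Kgroup c)) GL"
proof -
  interpret group "GL :: (real^2^2) monoid" by (rule group_GL)
  have mult: "Amat c a b ** Amat c a' b' = Amat c (a * a' + b * b' / c^2) (a * b' + b * a')" for a b a' b'
    by (simp add: Amat_def vec_eq_iff forall_2 matrix_matrix_mult_def sum_2 add_divide_distrib algebra_simps)
  have one: "Amat c 1 0 = mat 1"
    by (simp add: Amat_def vec_eq_iff forall_2 mat_def)
  define P where "P a b \<longleftrightarrow> a^2 - b^2 / c^2 > 0 \<and> a > 0" for a b
  have P_iff: "P a b \<longleftrightarrow> a + b / c > 0 \<and> a - b / c > 0" for a b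
  proof -
    have eq: "a^2 - b^2 / c^2 = (a + b / c) * (a - b / c)"
      by (simp add: algebra_simps power2_eq_square)
    show ?thesis unfolding P_def eq by (auto simp: zero_less_mult_iff)
  qed
  have P_mult: "P (a * a' + b * b' / c^2) (a * b' + b * a')" if "P a b" "P a' b'" for a b a' b'
  proof -
    have "(a * a' + b * b' / c^2) + (a * b' + b * a') / c = (a + b / c) * (a' + b' / c)"
         "(a * a' + b * b' / c^2) - (a * b' + b * a') / c = (a - b / c) * (a' - b' / c)"
      using c by (simp_all add: field_simps power2_eq_square)
    then show ?thesis using that by (simp add: P_iff)
  qed
  have inv: "\<exists>a' b'. P a' b' \<and> Amat c a b ** Amat c a' b' = mat 1" if "P a b" for a b
  proof -
    define D where "D = a^2 - b^2 / c^2"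
    have D: "D > 0" "a > 0" using that by (auto simp: P_def D_def)
    have "P (a / D) (- b / D)"
    proof -
      have "a / D + (- b / D) / c = (a - b / c) / D" "a / D - (- b / D) / c = (a + b / c) / D"
        by (simp_all add: field_simps diff_divide_distrib add_divide_distrib)
      then show ?thesis using that D by (simp add: P_iff)
    qed
    moreover have "a * (a / D) + b * (- b / D) / c^2 = (a^2 - b^2 / c^2) / D"
      by (simp add: diff_divide_distrib power2_eq_square mult.commute)
    then have "a * (a / D) + b * (- b / D) / c^2 = 1"
      using D by (simp add: D_def[symmetric])
    then have "Amat c a b ** Amat c (a / D) (- b / D) = mat 1"
      using D by (simp add: mult one[symmetric])
    ultimately show ?thesis by blast
  qed
  have comm: "Amat c a b ** Amat c a' b' = Amat c a' b' ** Amat c a b" for a b a' b'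
    by (simp add: mult algebra_simps)
  have K: "carrier (Kgroup c) = {Amat c a b | a b. P a b}"
    by (simp add: Kgroup_def P_def)
  have GL: "Amat c a b \<in> carrier GL" if P: "P a b" for a b
  proof -
    obtain a' b' where "Amat c a b ** Amat c a' b' = mat 1"
      using inv[OF P] by blast
    moreover from this have "Amat c a' b' ** Amat c a b = mat 1"
      by (simp only: comm[of a' b'])
    ultimately show ?thesis by (auto simp: GL_def invertible_def)
  qed
  show ?thesis
  proof (rule subgroupI)
    show "carrier (Kgroup c) \<subseteq> carrier GL" using GL by (auto simp: K)
    have "P 1 0" by (simp add: P_def)
    then show "carrier (Kgroup c) \<noteq> {}" by (auto simp: K)
  next
    fix x assume "x \<in> carrier (Kgroup c)"
    then obtain a b where x: "x = Amat c a b" "P a b" by (auto simp: K)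
    then obtain a' b' where y: "P a' b'" "Amat c a b ** Amat c a' b' = mat 1" using inv by blast
    have "inv\<^bsub>GL\<^esub> x = Amat c a' b'"
    proof (rule inv_equality)
      have "Amat c a' b' ** Amat c a b = mat 1"
        using y(2) by (simp only: comm[of a' b'])
      then show "Amat c a' b' \<otimes>\<^bsub>GL\<^esub> x = \<one>\<^bsub>GL\<^esub>"
        by (simp add: GL_def x)
    qed (simp_all add: GL x y)
    then show "inv\<^bsub>GL\<^esub> x \<in> carrier (Kgroup c)" using y by (auto simp: K)
  next
    fix x y assume "x \<in> carrier (Kgroup c)" "y \<in> carrier (Kgroup c)"
    then obtain a b a' b' where xy: "x = Amat c a b" "P a b" "y = Amat c a' b'" "P a' b'" by (auto simp: K)
    have "x \<otimes>\<^bsub>GL\<^esub> y = Amat c (a * a' + b * b' / c^2) (a * b' + b * a')"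
      using xy by (simp add: GL_def mult)
    then show "x \<otimes>\<^bsub>GL\<^esub> y \<in> carrier (Kgroup c)"
      using P_mult[OF xy(2,4)] unfolding K by blast
  qed
qed

lemma group_Kgroup:
  assumes "c > 0"
  shows "group (Kgroup c)"
proof -
  have "GL\<lparr>carrier := carrier (Kgroup c)\<rparr> = Kgroup c"
    by (simp add: Kgroup_def)
  then show ?thesis
    using subgroup.subgroup_is_group[OF subgroup_Kgroup[OF assms] group_GL] by simp
qed

lemma lie_subgroup_Kgroup:
  assumes c: "c > 0"
  shows "lie_subgroup 2 GL (carrier (Kgroup c))"
proof -
  define V where "V = range (\<lambda>(a, b). Amat c a b)"
  define U :: "(real^2^2) set" where
    "U = {M. 0 < M$1$1} \<inter> {M. 0 < (M$1$1)^2 - (M$1$2)^2 / c^2}"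
  have lin: "linear (\<lambda>(a, b). Amat c a b)"
    by (rule linearI) (auto simp: Amat_def vec_eq_iff forall_2 add_divide_distrib)
  have inj: "inj (\<lambda>(a, b). Amat c a b)"
    by (auto simp: inj_on_def Amat_def vec_eq_iff forall_2)
  have "dim V = dim (UNIV :: (real \<times> real) set)"
    unfolding V_def using lin inj by (simp add: dim_image_eq)
  then have dim: "dim V = 2" by simp
  have sub: "subspace V"
    unfolding V_def using lin by (simp add: linear_subspace_image)
  have "open U"
    unfolding U_def by (intro open_Int open_Collect_less continuous_intros) (use c in auto)
  then have diffeo: "diffeomorphism U U (\<lambda>x. x) (\<lambda>x. x)"
    by (simp add: diffeomorphism_def smooth_on_ident homeomorphism_def)
  have entry: "Amat c a b $ 1 $ 1 = a" "Amat c a b $ 1 $ 2 = b" for a b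
    by (simp_all add: Amat_def)
  have KU: "carrier (Kgroup c) = U \<inter> V"
  proof (intro equalityI subsetI)
    fix M assume "M \<in> carrier (Kgroup c)"
    then obtain a b where "M = Amat c a b" "a^2 - b^2 / c^2 > 0" "a > 0"
      by (auto simp: Kgroup_def)
    then show "M \<in> U \<inter> V"
      by (simp add: U_def V_def entry image_iff) blast
  next
    fix M assume "M \<in> U \<inter> V"
    then obtain a b where "M = Amat c a b" "a^2 - b^2 / c^2 > 0" "a > 0"
      by (auto simp: U_def V_def entry)
    then show "M \<in> carrier (Kgroup c)"
      by (simp add: Kgroup_def) blast
  qed
  have "embedded_submanifold 2 (carrier (Kgroup c))"
    unfolding embedded_submanifold_def
  proof (intro ballI)
    fix p assume "p \<in> carrier (Kgroup c)"
    then have p: "p \<in> U \<and> diffeomorphism U U (\<lambda>x. x) (\<lambda>x. x) \<and> subspace V \<and> dim V = 2 \<and>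
        (\<lambda>x. x) ` (U \<inter> carrier (Kgroup c)) = U \<inter> V"
      using diffeo sub dim KU by auto
    show "\<exists>U' W f g V. p \<in> U' \<and> diffeomorphism U' W f g \<and> subspace (V :: (real^2^2) set) \<and> dim V = 2 \<and>
        f ` (U' \<inter> carrier (Kgroup c)) = W \<inter> V"
      by (rule exI[of _ U], rule exI[of _ U], rule exI[of _ "\<lambda>x. x"], rule exI[of _ "\<lambda>x. x"],
          rule exI[of _ V], rule p)
  qed
  then show ?thesis
    using subgroup_Kgroup[OF c] by (simp add: lie_subgroup_def)
qed

end

(* Every element of the group is exp t * L^s for exactly one pair (t, s), and (t, s) |-> exp t * L^s is a
   homomorphism from the plane. It turns the subgroups of the family into the lines through the origin,
   which cover the plane and meet pairwise only in 0. In the light-cone coordinates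
   (ln (a + b/c), ln (a - b/c)) = (t + s, t - s), completed to a chart of an open set of matrices, these
   subgroups become one-dimensional linear subspaces. *)

theory Submission
  imports Defs
begin

section \<open>Smoothness of ridge functions\<close>

text \<open>Near a point of an open \<open>S\<close> the two functions agree, so they have the same
  derivative there. Equality on \<open>S\<close> thus passes to all directional derivatives, which
  feeds the induction.\<close>

lemma Ck_on_cong:
  assumes "open S" "\<And>x. x \<in> S \<Longrightarrow> f x = g x" "Ck_on k f S"
  shows "Ck_on k g S"
  using assms(2,3)
proof (induction k arbitrary: f g)
  case 0
  then show ?case by (metis Ck_on.simps(1) continuous_on_cong)
next
  case (Suc k)
  have g: "(g has_derivative frechet_derivative f (at x)) (at x)" if "x \<in> S" for x
  proof (rule has_derivative_transform_within_open[OF _ \<open>open S\<close> that])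
    show "(f has_derivative frechet_derivative f (at x)) (at x)"
      using Suc.prems(2) that frechet_derivative_works by auto
  qed (use Suc.prems(1) in auto)
  have "Ck_on k (\<lambda>x. frechet_derivative g (at x) v) S" for v
  proof (rule Suc.IH)
    show "frechet_derivative f (at x) v = frechet_derivative g (at x) v" if "x \<in> S" for x
      using frechet_derivative_at[OF g[OF that]] by simp
  qed (use Suc.prems(2) in auto)
  then show ?case using g by (auto simp: differentiable_def)
qed

text \<open>By uniqueness of derivatives, an explicit formula \<open>f'\<close> may replace the
  choice-defined \<open>frechet_derivative\<close>.\<close>

lemma Ck_on_SucI:
  assumes "open S" "\<And>x. x \<in> S \<Longrightarrow> (f has_derivative f' x) (at x)"
    and "\<And>v. Ck_on k (\<lambda>x. f' x v) S"
  shows "Ck_on (Suc k) f S"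
proof -
  have "Ck_on k (\<lambda>x. frechet_derivative f (at x) v) S" for v
    by (rule Ck_on_cong[OF assms(1) _ assms(3)[of v]])
       (use frechet_derivative_at[OF assms(2)] in metis)
  then show ?thesis using assms(2) by (auto simp: differentiable_def)
qed

lemma Ck_on_add:
  assumes "open S" "Ck_on k f S" "Ck_on k g S"
  shows "Ck_on k (\<lambda>x. f x + g x) S"
  using assms(2,3)
proof (induction k arbitrary: f g)
  case 0
  then show ?case by (auto intro: continuous_on_add)
next
  case (Suc k)
  show ?case
  proof (rule Ck_on_SucI[OF \<open>open S\<close>])
    fix x assume "x \<in> S"
    then show "((\<lambda>x. f x + g x) has_derivative
        (\<lambda>v. frechet_derivative f (at x) v + frechet_derivative g (at x) v)) (at x)"
      using Suc.prems frechet_derivative_works by (intro has_derivative_add) auto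
  qed (use Suc in auto)
qed

lemma smooth_on_add:
  "\<lbrakk>open S; smooth_on f S; smooth_on g S\<rbrakk> \<Longrightarrow> smooth_on (\<lambda>x. f x + g x) S"
  by (simp add: smooth_on_def Ck_on_add)

lemma smooth_on_continuous_on: "smooth_on f S \<Longrightarrow> continuous_on S f"
  unfolding smooth_on_def by (metis Ck_on.simps(1))

text \<open>\<open>\<xi> n\<close> plays the n-th derivative of \<open>\<xi> 0\<close> on the values
  of \<open>l\<close>. In direction \<open>v\<close> the derivative is again of this shape:
  \<open>l v\<close> is constant in \<open>x\<close> and is absorbed into the vector, while
  \<open>n\<close> goes up by one. So induction on the order, with \<open>n\<close> and
  \<open>A\<close> arbitrary, needs no product rule for \<open>Ck_on\<close>.\<close>

lemma smooth_on_ridge: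
  fixes l :: "'a::euclidean_space \<Rightarrow> real" and A :: "'b::euclidean_space"
    and \<xi> :: "nat \<Rightarrow> real \<Rightarrow> real"
  assumes S: "open S" and l: "linear l"
    and \<xi>: "\<And>n x. x \<in> S \<Longrightarrow> (\<xi> n has_real_derivative \<xi> (Suc n) (l x)) (at (l x))"
  shows "smooth_on (\<lambda>x. \<xi> 0 (l x) *\<^sub>R A) S"
proof -
  have bl: "bounded_linear l" using l by (simp add: linear_conv_bounded_linear)
  have deriv: "((\<lambda>x. \<xi> n (l x) *\<^sub>R A) has_derivative (\<lambda>v. \<xi> (Suc n) (l x) *\<^sub>R (l v *\<^sub>R A))) (at x)"
    if "x \<in> S" for n x and A :: 'b
  proof -
    have "((\<lambda>x. \<xi> n (l x)) has_derivative (\<lambda>v. l v * \<xi> (Suc n) (l x))) (at x)"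
      using has_derivative_compose[OF bounded_linear_imp_has_derivative[OF bl]
          \<xi>[OF that, of n, unfolded has_field_derivative_def]]
      by (simp add: mult.commute)
    from has_derivative_scaleR_left[OF this, of A] show ?thesis
      by (simp add: mult.commute)
  qed
  have "Ck_on k (\<lambda>x. \<xi> n (l x) *\<^sub>R A) S" for k n and A :: 'b
  proof (induction k arbitrary: n A)
    case 0
    have "continuous_on S (\<lambda>x. \<xi> n (l x) *\<^sub>R A)"
      by (intro continuous_at_imp_continuous_on ballI has_derivative_continuous[OF deriv])
    then show ?case by simp
  next
    case (Suc k)
    show ?case by (rule Ck_on_SucI[OF S deriv Suc])
  qed
  then show ?thesis by (simp add: smooth_on_def)
qed

lemma smooth_on_exp_ridge:
  assumes "open S" "linear l"
  shows "smooth_on (\<lambda>x. exp (l x) *\<^sub>R A) S"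
  using smooth_on_ridge[OF assms, of "\<lambda>n. exp" A] by (simp add: DERIV_exp)

lemma smooth_on_linear_ridge:
  assumes "open S" "linear l"
  shows "smooth_on (\<lambda>x. l x *\<^sub>R A) S"
proof -
  define \<xi> :: "nat \<Rightarrow> real \<Rightarrow> real"
    where "\<xi> n y = (if n = 0 then y else if n = 1 then 1 else 0)" for n y
  have "(\<xi> n has_real_derivative \<xi> (Suc n) y) (at y)" for n y
    unfolding \<xi>_def by (cases "n = 0"; cases "n = 1") (auto intro!: derivative_eq_intros)
  then have "smooth_on (\<lambda>x. \<xi> 0 (l x) *\<^sub>R A) S"
    by (intro smooth_on_ridge assms)
  then show ?thesis by (simp add: \<xi>_def)
qed

lemma smooth_on_ln_ridge:
  assumes "open S" "linear l" and pos: "\<And>x. x \<in> S \<Longrightarrow> l x > 0"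
  shows "smooth_on (\<lambda>x. ln (l x) *\<^sub>R A) S"
proof -
  \<comment> \<open>The derivative of order m + 1 of ln at y > 0 is (-1)^m m! / y^(m+1); the
    logarithm itself is the separate case of order 0.\<close>
  define \<xi> :: "nat \<Rightarrow> real \<Rightarrow> real"
    where "\<xi> n = (case n of 0 \<Rightarrow> ln | Suc m \<Rightarrow> (\<lambda>y. (-1)^m * fact m * inverse y ^ Suc m))" for n
  have "(\<xi> n has_real_derivative \<xi> (Suc n) y) (at y)" if "y > 0" for n y
  proof (cases n)
    case 0
    then show ?thesis using that DERIV_ln by (simp add: \<xi>_def)
  next
    case (Suc m)
    have "((\<lambda>y::real. inverse y ^ Suc m) has_real_derivative - (real (Suc m) * inverse y ^ Suc (Suc m))) (at y)"
      by (rule derivative_eq_intros refl | use that in \<open>simp add: field_simps\<close>)+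
    from DERIV_cmult[OF this, of "(-1)^m * fact m"] show ?thesis
      by (simp add: \<xi>_def Suc algebra_simps)
  qed
  then have "smooth_on (\<lambda>x. \<xi> 0 (l x) *\<^sub>R A) S"
    by (intro smooth_on_ridge assms) (simp add: pos)
  then show ?thesis by (simp add: \<xi>_def)
qed


section \<open>Exponential coordinates on the group\<close>

text \<open>This is the polar form of hyperbolic numbers: \<open>exp t\<close> is the modulus
  sqrt(a^2 - b^2/c^2) and \<open>s\<close> is the rapidity.\<close>

definition polar :: "real \<Rightarrow> real \<Rightarrow> real \<Rightarrow> real^2^2" where
  "polar c t s = exp t *\<^sub>R Lmat c s"

lemma Phi_eq_polar: "Phi c a b = range (\<lambda>s. polar c (a * s) (b * s))"
  by (auto simp: Phi_def polar_def)

lemma polar_entries: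
  "polar c t s $ 1 $ 1 = exp t * cosh s" "polar c t s $ 1 $ 2 = c * (exp t * sinh s)"
  "polar c t s $ 2 $ 1 = exp t * sinh s / c" "polar c t s $ 2 $ 2 = exp t * cosh s"
  by (simp_all add: polar_def Lmat_def)

text \<open>For \<open>polar c t s\<close> with first row (a, b), these are the eigenvalues a + b/c
  and a - b/c. Passing to them replaces hyperbolic functions by exponentials, which are inverted by
  logarithms.\<close>

lemma exp_add_cosh_sinh:
  fixes t s :: real
  shows "exp t * cosh s + exp t * sinh s = exp (t + s)" "exp t * cosh s - exp t * sinh s = exp (t - s)"
  by (simp_all add: exp_add exp_diff cosh_field_def sinh_field_def exp_minus field_simps)

lemma cosh_sinh_of_lightcone:
  fixes t s :: real
  shows "(exp (t + s) + exp (t - s)) / 2 = exp t * cosh s" "(exp (t + s) - exp (t - s)) / 2 = exp t * sinh s"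
  by (simp_all flip: exp_add_cosh_sinh)

lemma polar_mult:
  assumes "c \<noteq> 0"
  shows "polar c t s ** polar c t' s' = polar c (t + t') (s + s')"
  using assms
  by (simp add: vec_eq_iff forall_2 matrix_matrix_mult_def sum_2 polar_entries exp_add cosh_add sinh_add
      field_simps)

lemma polar_0: "polar c 0 0 = mat 1"
  by (simp add: vec_eq_iff forall_2 polar_entries mat_def)

text \<open>The first row fixes both eigenvalues, hence t + s and t - s by injectivity of exp, hence
  t and s.\<close>

lemma polar_inj:
  assumes "c \<noteq> 0" "polar c t s = polar c t' s'"
  shows "t = t' \<and> s = s'"
proof -
  have "exp t * cosh s = exp t' * cosh s'" "exp t * sinh s = exp t' * sinh s'"
    using arg_cong[OF assms(2), of "\<lambda>M. M $ 1 $ 1"] arg_cong[OF assms(2), of "\<lambda>M. M $ 1 $ 2"] assms(1)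
    by (simp_all add: polar_entries)
  then have "exp (t + s) = exp (t' + s')" "exp (t - s) = exp (t' - s')"
    by (simp_all flip: exp_add_cosh_sinh)
  then show ?thesis by simp
qed

lemma carrier_Kgroup_eq_polar:
  assumes c: "c > 0"
  shows "carrier (Kgroup c) = range (\<lambda>(t, s). polar c t s)"
proof (intro equalityI subsetI)
  fix M assume "M \<in> carrier (Kgroup c)"
  then obtain a b where M: "M = Amat c a b" and ab: "a^2 - b^2 / c^2 > 0" "a > 0"
    by (auto simp: Kgroup_def)
  have "a^2 - b^2 / c^2 = (a + b / c) * (a - b / c)"
    by (simp add: algebra_simps power2_eq_square)
  \<comment> \<open>The factors have the same sign, and their sum 2a is positive.\<close>
  then have pos: "a + b / c > 0" "a - b / c > 0"
    using ab by (auto simp: zero_less_mult_iff)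
  \<comment> \<open>Solves t + s = ln (a + b/c) and t - s = ln (a - b/c).\<close>
  define t where "t = (ln (a + b / c) + ln (a - b / c)) / 2"
  define s where "s = (ln (a + b / c) - ln (a - b / c)) / 2"
  have "exp (t + s) = a + b / c" "exp (t - s) = a - b / c"
    using pos by (simp_all add: t_def s_def field_simps)
  then have "exp t * cosh s = a" "exp t * sinh s = b / c"
    by (simp_all flip: cosh_sinh_of_lightcone)
  then have "M = polar c t s"
    using c by (simp add: M Amat_def vec_eq_iff forall_2 polar_entries power2_eq_square)
  then show "M \<in> range (\<lambda>(t, s). polar c t s)" by auto
next
  fix M assume "M \<in> range (\<lambda>(t, s). polar c t s)"
  then obtain t s where M: "M = polar c t s" by auto
  have "M = Amat c (exp t * cosh s) (c * (exp t * sinh s))"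
    using c by (simp add: M Amat_def vec_eq_iff forall_2 polar_entries power2_eq_square)
  moreover have "(exp t * cosh s)^2 - (c * (exp t * sinh s))^2 / c^2 = (exp t)^2"
    using c by (simp add: power_mult_distrib cosh_square_eq algebra_simps)
  then have "(exp t * cosh s)^2 - (c * (exp t * sinh s))^2 / c^2 > 0" by simp
  moreover have "exp t * cosh s > 0" by simp
  moreover have "carrier (Kgroup c) = {Amat c a b | a b. a^2 - b^2 / c^2 > 0 \<and> a > 0}"
    by (simp add: Kgroup_def)
  ultimately show "M \<in> carrier (Kgroup c)" by blast
qed

section \<open>The sets \<open>Phi\<close> as connected subgroups\<close>

lemma subgroup_Phi:
  assumes c: "c > 0"
  shows "subgroup (Phi c a b) (Kgroup c)"
proof -
  interpret group "Kgroup c" by (rule group_Kgroup[OF c])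
  have K: "polar c t s \<in> carrier (Kgroup c)" for t s
    using carrier_Kgroup_eq_polar[OF c] by auto
  have mult: "polar c t s \<otimes>\<^bsub>Kgroup c\<^esub> polar c t' s' = polar c (t + t') (s + s')" for t s t' s'
    using c by (simp add: Kgroup_def GL_def polar_mult)
  have one: "\<one>\<^bsub>Kgroup c\<^esub> = polar c 0 0"
    by (simp add: Kgroup_def GL_def polar_0)
  have inverse: "inv\<^bsub>Kgroup c\<^esub> polar c t s = polar c (- t) (- s)" for t s
    by (rule inv_equality) (simp_all add: mult one K)
  show ?thesis
  proof (rule subgroupI)
    fix x assume "x \<in> Phi c a b"
    then obtain s where "x = polar c (a * s) (b * s)" by (auto simp: Phi_eq_polar)
    then have "inv\<^bsub>Kgroup c\<^esub> x = polar c (a * (- s)) (b * (- s))" by (simp add: inverse)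
    then show "inv\<^bsub>Kgroup c\<^esub> x \<in> Phi c a b" unfolding Phi_eq_polar by blast
  next
    fix x y assume "x \<in> Phi c a b" "y \<in> Phi c a b"
    then obtain s s' where "x = polar c (a * s) (b * s)" "y = polar c (a * s') (b * s')"
      by (auto simp: Phi_eq_polar)
    then have "x \<otimes>\<^bsub>Kgroup c\<^esub> y = polar c (a * (s + s')) (b * (s + s'))"
      by (simp add: mult distrib_left)
    then show "x \<otimes>\<^bsub>Kgroup c\<^esub> y \<in> Phi c a b" unfolding Phi_eq_polar by blast
  qed (auto simp: Phi_eq_polar K)
qed

lemma connected_Phi: "connected (Phi c a b)"
proof -
  have "continuous_on UNIV (\<lambda>s. polar c (a * s) (b * s) $ i $ j)" for i j
  proof -
    have "\<forall>i j. continuous_on UNIV (\<lambda>s. polar c (a * s) (b * s) $ i $ j)"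
      unfolding forall_2 polar_entries divide_inverse by (intro conjI continuous_intros)
    then show ?thesis by blast
  qed
  then have "continuous_on UNIV (\<lambda>s. \<chi> i j. polar c (a * s) (b * s) $ i $ j)"
    by (intro continuous_on_vec_lambda)
  then show ?thesis
    unfolding Phi_eq_polar by (intro connected_continuous_image) simp_all
qed


section \<open>The light-cone chart\<close>

text \<open>Only the first row is constrained, so the domain is open in the four-dimensional space
  of all matrices and not just in the plane of the matrices \<open>Amat c a b\<close>.\<close>

definition lc_domain :: "real \<Rightarrow> (real^2^2) set" where
  "lc_domain c = {M. 0 < M$1$1 + M$1$2 / c} \<inter> {M. 0 < M$1$1 - M$1$2 / c}"

text \<open>The second row measures the deviation from the shape \<open>Amat\<close>: it vanishes
  exactly when the matrix is \<open>Amat\<close> of its own first row. The first row holds the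
  light-cone coordinates.\<close>

definition lc_chart :: "real \<Rightarrow> real^2^2 \<Rightarrow> real^2^2" where
  "lc_chart c M = vector [vector [ln (M$1$1 + M$1$2 / c), ln (M$1$1 - M$1$2 / c)],
                          vector [M$2$1 - M$1$2 / c^2, M$2$2 - M$1$1]]"

text \<open>Obtained by solving the chart equations for the matrix; the term divided by 2 and by c
  is b/c^2 for the entry b of the first row.\<close>

definition lc_param :: "real \<Rightarrow> real^2^2 \<Rightarrow> real^2^2" where
  "lc_param c N = vector
     [vector [(exp (N$1$1) + exp (N$1$2)) / 2, c * ((exp (N$1$1) - exp (N$1$2)) / 2)],
      vector [N$2$1 + (exp (N$1$1) - exp (N$1$2)) / 2 / c, N$2$2 + (exp (N$1$1) + exp (N$1$2)) / 2]]"

lemma open_lc_domain: "c > 0 \<Longrightarrow> open (lc_domain c)"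
  unfolding lc_domain_def by (intro open_Int open_Collect_less continuous_intros) auto

lemma smooth_on_lc_chart:
  assumes c: "c > 0"
  shows "smooth_on (lc_chart c) (lc_domain c)"
proof -
  note dom = open_lc_domain[OF c]
  have lin: "linear (\<lambda>M::real^2^2. M$1$1 + M$1$2 / c)" "linear (\<lambda>M::real^2^2. M$1$1 - M$1$2 / c)"
    "linear (\<lambda>M::real^2^2. M$2$1 - M$1$2 / c^2)" "linear (\<lambda>M::real^2^2. M$2$2 - M$1$1)"
    by (rule linearI; simp add: add_divide_distrib distrib_left right_diff_distrib)+
  \<comment> \<open>One ridge function per entry, each multiplied by a matrix unit.\<close>
  have eq: "lc_chart c = (\<lambda>M.
      ln (M$1$1 + M$1$2 / c) *\<^sub>R vector [vector [1, 0], vector [0, 0]]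
      + ln (M$1$1 - M$1$2 / c) *\<^sub>R vector [vector [0, 1], vector [0, 0]]
      + (M$2$1 - M$1$2 / c^2) *\<^sub>R vector [vector [0, 0], vector [1, 0]]
      + (M$2$2 - M$1$1) *\<^sub>R vector [vector [0, 0], vector [0, 1]])"
    by (rule ext) (simp add: lc_chart_def vec_eq_iff forall_2)
  show ?thesis unfolding eq
    by (rule smooth_on_add[OF dom smooth_on_add[OF dom smooth_on_add[OF dom
          smooth_on_ln_ridge[OF dom lin(1)] smooth_on_ln_ridge[OF dom lin(2)]]
          smooth_on_linear_ridge[OF dom lin(3)]] smooth_on_linear_ridge[OF dom lin(4)]])
       (simp_all add: lc_domain_def)
qed

lemma smooth_on_lc_param: "smooth_on (lc_param c) UNIV"
proof -
  have lin: "linear (\<lambda>N::real^2^2. N$i$j)" for i j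
    by (rule linearI) simp_all
  \<comment> \<open>Collected by the coordinates of \<open>N\<close>: each exponential enters all
    four entries, so its coefficient is a full matrix.\<close>
  have eq: "lc_param c = (\<lambda>N.
      exp (N$1$1) *\<^sub>R vector [vector [1/2, c/2], vector [1 / (2 * c), 1/2]]
      + exp (N$1$2) *\<^sub>R vector [vector [1/2, - c/2], vector [- 1 / (2 * c), 1/2]]
      + N$2$1 *\<^sub>R vector [vector [0, 0], vector [1, 0]]
      + N$2$2 *\<^sub>R vector [vector [0, 0], vector [0, 1]])"
    by (rule ext)
       (simp add: lc_param_def vec_eq_iff forall_2 add_divide_distrib diff_divide_distrib algebra_simps)
  show ?thesis unfolding eq
    by (rule smooth_on_add[OF open_UNIV smooth_on_add[OF open_UNIV smooth_on_add[OF open_UNIV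
          smooth_on_exp_ridge[OF open_UNIV lin] smooth_on_exp_ridge[OF open_UNIV lin]]
          smooth_on_linear_ridge[OF open_UNIV lin]] smooth_on_linear_ridge[OF open_UNIV lin]])
qed

lemma diffeomorphism_lc_chart:
  assumes c: "c > 0"
  shows "diffeomorphism (lc_domain c) UNIV (lc_chart c) (lc_param c)"
proof -
  have param: "lc_param c (lc_chart c M) = M" if "M \<in> lc_domain c" for M
    using that c
    by (simp add: lc_domain_def lc_param_def lc_chart_def vec_eq_iff forall_2 power2_eq_square)
  have sum: "(x + y) / 2 + (x - y) / 2 = x" "(x + y) / 2 - (x - y) / 2 = y" for x y :: real
    by (simp_all add: field_simps)
  have dom: "lc_param c N \<in> lc_domain c" for N
    using c by (simp add: lc_domain_def lc_param_def sum)
  have chart: "lc_chart c (lc_param c N) = N" for N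
    using c by (simp add: lc_param_def lc_chart_def vec_eq_iff forall_2 power2_eq_square sum)
  have "homeomorphism (lc_domain c) UNIV (lc_chart c) (lc_param c)"
    using param dom chart smooth_on_continuous_on[OF smooth_on_lc_chart[OF c]]
      smooth_on_continuous_on[OF smooth_on_lc_param]
    by (intro homeomorphismI) auto
  then show ?thesis
    using c by (simp add: diffeomorphism_def open_lc_domain smooth_on_lc_chart smooth_on_lc_param)
qed

lemma polar_in_lc_domain: "c > 0 \<Longrightarrow> polar c t s \<in> lc_domain c"
  \<comment> \<open>The difference a - b/c has to stay intact to be recognised as
    \<open>exp (t - s)\<close>.\<close>
  by (simp add: lc_domain_def polar_entries exp_add_cosh_sinh del: diff_gt_0_iff_gt)

lemma lc_chart_polar:
  "c > 0 \<Longrightarrow> lc_chart c (polar c t s) = vector [vector [t + s, t - s], vector [0, 0]]"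
  by (simp add: lc_chart_def polar_entries exp_add_cosh_sinh power2_eq_square)

text \<open>A single chart serves all points, since \<open>Phi c a b\<close> lies inside its domain
  and is mapped onto a whole line through 0.\<close>

lemma embedded_submanifold_Phi:
  assumes c: "c > 0" and ab: "a \<noteq> 0 \<or> b \<noteq> 0"
  shows "embedded_submanifold 1 (Phi c a b)"
proof -
  \<comment> \<open>The direction (a, b) of the (t, s) plane in light-cone coordinates; it is
    nonzero because a + b = a - b = 0 would force a = b = 0.\<close>
  define v :: "real^2^2" where "v = vector [vector [a + b, a - b], vector [0, 0]]"
  have "v \<noteq> 0" using ab by (auto simp: v_def vec_eq_iff forall_2)
  then have dim: "dim (span {v}) = 1" by (simp add: dim_eq_card_independent)
  have chart: "lc_chart c (polar c (a * s) (b * s)) = s *\<^sub>R v" for s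
    using c by (simp add: lc_chart_polar v_def vec_eq_iff forall_2 algebra_simps)
  have "lc_domain c \<inter> Phi c a b = Phi c a b"
    using polar_in_lc_domain[OF c] by (auto simp: Phi_eq_polar)
  then have image: "lc_chart c ` (lc_domain c \<inter> Phi c a b) = UNIV \<inter> span {v}"
    by (simp add: Phi_eq_polar image_image chart span_singleton)
  have "Phi c a b \<subseteq> lc_domain c"
    using polar_in_lc_domain[OF c] by (auto simp: Phi_eq_polar)
  then show ?thesis
    unfolding embedded_submanifold_def
    using diffeomorphism_lc_chart[OF c] subspace_span[of "{v}"] dim image by blast
qed

section \<open>Covering by the subgroups and their pairwise intersections\<close>

theorem mainTheorem2:
  fixes c :: real
  assumes "c > 0"
  shows "(\<forall>H\<in>Kfamily c. lie_subgroup 1 (Kgroup c) H \<and> connected H)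
    \<and> carrier (Kgroup c) = SOplus c \<union> (\<Union>a\<in>{a. a \<noteq> 0}. Phi c a 1) \<union> Phi c 1 0
    \<and> (\<forall>H\<in>Kfamily c. \<forall>H'\<in>Kfamily c. H \<noteq> H' \<longrightarrow> H \<inter> H' = {mat 1})"
proof (intro conjI)
  have c: "c \<noteq> 0" using assms by simp
  \<comment> \<open>The Lorentz group is the case a = 0 of \<open>Phi c a 1\<close>, which leaves
    two shapes of members.\<close>
  have family: "Kfamily c = insert (Phi c 1 0) (range (\<lambda>a. Phi c a 1))"
    by (auto simp: Kfamily_def SOplus_def)
  show "\<forall>H\<in>Kfamily c. lie_subgroup 1 (Kgroup c) H \<and> connected H"
    using assms subgroup_Phi embedded_submanifold_Phi connected_Phi
    unfolding family lie_subgroup_def by (metis imageE insertE zero_neq_one)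
  \<comment> \<open>The point (t, s) lies on the line with direction (t/s, 1) if s is nonzero, and
    with direction (1, 0) otherwise.\<close>
  have cover: "polar c t s \<in> (\<Union>a. Phi c a 1) \<union> Phi c 1 0" for t s
  proof (cases "s = 0")
    case True
    then have "polar c t s = polar c (1 * t) (0 * t)" by simp
    then show ?thesis unfolding Phi_eq_polar by blast
  next
    case False
    then have "polar c t s = polar c (t / s * s) (1 * s)" by simp
    then show ?thesis unfolding Phi_eq_polar by blast
  qed
  have "carrier (Kgroup c) = (\<Union>a. Phi c a 1) \<union> Phi c 1 0"
  proof
    show "carrier (Kgroup c) \<subseteq> (\<Union>a. Phi c a 1) \<union> Phi c 1 0"
    proof
      fix M assume "M \<in> carrier (Kgroup c)"
      then obtain t s where "M = polar c t s"
        unfolding carrier_Kgroup_eq_polar[OF assms] by auto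
      then show "M \<in> (\<Union>a. Phi c a 1) \<union> Phi c 1 0" using cover by simp
    qed
    show "(\<Union>a. Phi c a 1) \<union> Phi c 1 0 \<subseteq> carrier (Kgroup c)"
      by (intro Un_least UN_least subgroup.subset subgroup_Phi assms)
  qed
  \<comment> \<open>Splits the Lorentz group off again as the parameter 0.\<close>
  also have "(UNIV :: real set) = insert 0 {a. a \<noteq> 0}" by auto
  also have "(\<Union>a\<in>insert 0 {a. a \<noteq> 0}. Phi c a 1) = SOplus c \<union> (\<Union>a\<in>{a. a \<noteq> 0}. Phi c a 1)"
    by (simp only: UN_insert SOplus_def)
  finally show "carrier (Kgroup c) = SOplus c \<union> (\<Union>a\<in>{a. a \<noteq> 0}. Phi c a 1) \<union> Phi c 1 0" .
  have one: "mat 1 \<in> Phi c a b" for a b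
    unfolding Phi_eq_polar by (rule image_eqI[of _ _ 0]) (simp_all add: polar_0)
  \<comment> \<open>The hypothesis says that the directions (a, b) and (a', b') have nonzero
    determinant, so the two lines meet only in the origin.\<close>
  have inter: "Phi c a b \<inter> Phi c a' b' = {mat 1}" if "a * b' \<noteq> a' * b" for a b a' b'
  proof -
    have "M = mat 1" if M: "M \<in> Phi c a b" "M \<in> Phi c a' b'" for M
    proof -
      obtain s s' where s: "M = polar c (a * s) (b * s)" and s': "M = polar c (a' * s') (b' * s')"
        using M unfolding Phi_eq_polar by (elim rangeE)
      have "a * s = a' * s'" "b * s = b' * s'"
        using polar_inj[OF c trans[OF s[symmetric] s']] by simp_all
      then have "(a * b' - a' * b) * s = 0" by algebra
      then have "s = 0" using \<open>a * b' \<noteq> a' * b\<close> by simp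
      then show ?thesis by (simp add: s polar_0)
    qed
    then show ?thesis using one by auto
  qed
  show "\<forall>H\<in>Kfamily c. \<forall>H'\<in>Kfamily c. H \<noteq> H' \<longrightarrow> H \<inter> H' = {mat 1}"
  proof (intro ballI impI)
    fix H H' assume H: "H \<in> Kfamily c" "H' \<in> Kfamily c" "H \<noteq> H'"
    \<comment> \<open>The determinants are a - a', -1 and 1 in the three cases, all nonzero.\<close>
    consider a a' where "H = Phi c a 1" "H' = Phi c a' 1" "a \<noteq> a'"
      | a where "H = Phi c a 1" "H' = Phi c 1 0" | a where "H = Phi c 1 0" "H' = Phi c a 1"
      using H by (auto simp: family)
    then show "H \<inter> H' = {mat 1}"
      by cases (simp_all add: inter)
  qed
qed

end
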